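(* For every integer $k\ge1$, $$G^{(k-1)(k-2)\cdots1k}_{31\text{-}2}(x)=\begin{cases}x^kC^3(x),&\text{if }k\ge2,\\ C(x),&\text{if }k=1,\end{cases}$$ where $C^3(x)=(C(x))^3$. Hence, for all $n\ge k$, $$N^{(k-1)(k-2)\cdots1k}_{31\text{-}2}(n)=\begin{cases}C_{n-k+2}-C_{n-k+1},&\text{if }k\ge2,\\ C_n,&\text{if }k=1.\end{cases}$$
   Context: A permutation $\pi=\pi_1\cdots\pi_n$ of $\{1,\dots,n\}$ contains the generalized pattern $31\text{-}2$ if there are indices $i,j$ with $i+1<j\le n$ such that $\pi_i\pi_{i+1}\pi_j$ is order-isomorphic to $312$; otherwise it avoids it. A permutation $\pi$ begins with a pattern $p=p_1\cdots p_k$ if $n\ge k$ and $\pi_1\cdots\pi_k$ is order-isomorphic to $p$; by convention, the empty permutation is also regarded as beginning with the pattern $1$ (the case $k=1$). The pattern $(k-1)(k-2)\cdots1k$ consists of $k-1,k-2,\dots,1$ in decreasing order followed by $k$ (for $k=1$ it is $1$, for $k=2$ it is $12$). $N^p_q(n)$ is the number of permutations of $\{1,\dots,n\}$ that avoid $q$ and begin with $p$, and $G^p_q(x)=\sum_{n\ge0}N^p_q(n)x^n$. $C(x)=\sum_{n\ge0}C_nx^n=\frac{1-\sqrt{1-4x}}{2x}$, with $C_n=\frac1{n+1}\binom{2n}{n}$ the Catalan numbers. *)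

theory Defs
  imports
    "HOL-Combinatorics.Multiset_Permutations"
    "HOL-Computational_Algebra.Formal_Power_Series"
begin

(* A permutation of {1..n} is represented by its one-line notation, i.e. by an element of
   permutations_of_set {1..n} :: nat list set; list positions are counted from 0. *)

definition order_isomorphic :: "nat list \<Rightarrow> nat list \<Rightarrow> bool" where
  "order_isomorphic xs ys \<longleftrightarrow> length xs = length ys \<and>
     (\<forall>i < length xs. \<forall>j < length xs. xs ! i < xs ! j \<longleftrightarrow> ys ! i < ys ! j)"

definition contains_31_2 :: "nat list \<Rightarrow> bool" where
  "contains_31_2 \<pi> \<longleftrightarrow>
     (\<exists>i j. i + 1 < j \<and> j < length \<pi> \<and> order_isomorphic [\<pi> ! i, \<pi> ! (i + 1), \<pi> ! j] [3, 1, 2])"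

(* The second disjunct is the convention that the empty permutation begins with the pattern 1. *)
definition begins_with :: "nat list \<Rightarrow> nat list \<Rightarrow> bool" where
  "begins_with p \<pi> \<longleftrightarrow>
     length p \<le> length \<pi> \<and> order_isomorphic (take (length p) \<pi>) p \<or> \<pi> = [] \<and> p = [1]"

(* The pattern (k-1)(k-2)...1k, for k at least 1 *)
definition prefix_pattern :: "nat \<Rightarrow> nat list" where
  "prefix_pattern k = rev [1..<k] @ [k]"

definition N_31_2 :: "nat list \<Rightarrow> nat \<Rightarrow> nat" where
  "N_31_2 p n = card {\<pi> \<in> permutations_of_set {1..n}. \<not> contains_31_2 \<pi> \<and> begins_with p \<pi>}"

definition G_31_2 :: "nat list \<Rightarrow> rat fps" where
  "G_31_2 p = Abs_fps (\<lambda>n. of_nat (N_31_2 p n))"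

definition catalan :: "nat \<Rightarrow> rat" where
  "catalan n = 1 / of_nat (n + 1) * of_nat ((2 * n) choose n)"

definition catalan_fps :: "rat fps" where
  "catalan_fps = Abs_fps catalan"

end

(* For permutations, avoiding 31-2 is the same as avoiding the classical pattern 312. Splitting a
   312-avoiding permutation at its minimum leaves two 312-avoiding parts, all letters of the first
   below all letters of the second, which gives the Catalan recursion and the case k = 1.

   If a 312-avoiding permutation starts with a descent c b, then c = b + 1, since b + 1 would
   otherwise complete a 312. Hence doubling the first letter is a bijection from the avoiders of
   length n onto those of length n + 1 that start with a descent. It leads from the prefix pattern
   for k to the one for k + 1, and its image has the complement counted by k = 2: this gives
   C_(m+2) - C_(m+1) permutations of length m + k for every k >= 2, and these differences are the
   coefficients of C^3 because C = 1 + x C^2. *)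

theory Submission
  imports Defs
begin

section \<open>Catalan numbers\<close>

text \<open>Two absorption steps through \<open>(2 * n + 1) choose n\<close> relate consecutive
  central binomials. Denominators are cleared to match the recurrence for generalized binomials in
  \<open>catalan_gbinomial\<close>.\<close>

lemma catalan_Suc: "of_nat (n + 2) * catalan (Suc n) = of_nat (2 * (2 * n + 1)) * catalan n"
proof -
  have a: "Suc n * ((2 * n + 1) choose n) = (2 * n + 1) * ((2 * n) choose n)"
    using binomial_absorb_comp[of "2 * n + 1" n] by simp
  have b: "Suc n * ((2 * n + 2) choose Suc n) = (2 * n + 2) * ((2 * n + 1) choose n)"
    using Suc_times_binomial[of n "2 * n + 1"] by simp
  \<comment> \<open>The extra factor \<open>Suc n\<close> makes \<open>a\<close> applicable after
    \<open>b\<close>; it is cancelled afterwards.\<close>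
  have "Suc n * (Suc n * ((2 * n + 2) choose Suc n)) = Suc n * (2 * (2 * n + 1) * ((2 * n) choose n))"
  proof -
    have "Suc n * (Suc n * ((2 * n + 2) choose Suc n)) = (2 * n + 2) * (Suc n * ((2 * n + 1) choose n))"
      unfolding b by (rule mult.left_commute)
    also have "\<dots> = Suc n * (2 * (2 * n + 1) * ((2 * n) choose n))"
      unfolding a by (simp add: algebra_simps)
    finally show ?thesis .
  qed
  then have "Suc n * ((2 * n + 2) choose Suc n) = 2 * (2 * n + 1) * ((2 * n) choose n)"
    by (simp only: mult_cancel1) simp
  then have "of_nat (Suc n) * (of_nat ((2 * n + 2) choose Suc n) :: rat)
      = of_nat (2 * (2 * n + 1)) * of_nat ((2 * n) choose n)"
    by (metis of_nat_mult)
  then show ?thesis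
    by (simp add: catalan_def field_simps del: binomial_Suc_Suc)
qed

text \<open>These are the coefficients of (1 - sqrt(1 - 4x)) / (2x), with the square root expanded
  as a binomial series. Both sides agree at 0 and obey the same first-order recurrence.\<close>

lemma catalan_gbinomial: "catalan n = - (1/2) * (- 4) ^ Suc n * ((1/2) gchoose Suc n)"
proof (induction n)
  case 0
  show ?case by (simp add: catalan_def)
next
  case (Suc n)
  \<comment> \<open>By absorption, both sides equal half of
    \<open>(-1/2) gchoose Suc n\<close>.\<close>
  have g: "of_nat (n + 2) * ((1/2 :: rat) gchoose Suc (Suc n)) = (1/2 - of_nat (Suc n)) * ((1/2) gchoose Suc n)"
    using gbinomial_absorb_comp[of "1/2::rat" "Suc n"] gbinomial_absorption[of "Suc n" "1/2::rat"]
    by simp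
  have "of_nat (n + 2) * catalan (Suc n)
      = of_nat (n + 2) * (- (1/2) * (- 4) ^ Suc (Suc n) * ((1/2) gchoose Suc (Suc n)))"
  proof -
    have "of_nat (n + 2) * (- (1/2) * (- 4) ^ Suc (Suc n) * ((1/2 :: rat) gchoose Suc (Suc n)))
        = - (1/2) * (- 4) ^ Suc (Suc n) * (of_nat (n + 2) * ((1/2) gchoose Suc (Suc n)))"
      by (simp only: mult_ac)
    \<comment> \<open>The product of -4 and 1/2 - (n + 1) is 2 (2n + 1), the factor in
      \<open>catalan_Suc\<close>.\<close>
    also have "\<dots> = of_nat (2 * (2 * n + 1)) * (- (1/2) * (- 4) ^ Suc n * ((1/2) gchoose Suc n))"
      unfolding g by (simp add: algebra_simps)
    finally show ?thesis
      unfolding catalan_Suc Suc by simp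
  qed
  then show ?case
    by (simp only: mult_cancel_left of_nat_eq_0_iff) simp
qed

text \<open>The square of sqrt(1 - 4x) has no terms beyond degree 1; in coefficients, Vandermonde at
  1/2 + 1/2 = 1 makes a sum vanish. Its two end terms give \<open>catalan (Suc n)\<close>, the inner
  ones the convolution.\<close>

lemma catalan_convolution: "catalan (Suc n) = (\<Sum>i\<le>n. catalan i * catalan (n - i))"
proof -
  let ?g = "\<lambda>k. (1/2 :: rat) gchoose k"
  have "(\<Sum>k=0..n + 2. ?g k * ?g (n + 2 - k)) = (1 gchoose (n + 2))"
    using gbinomial_Vandermonde[of "1/2 :: rat" "1/2" "n + 2"] by simp
  also have "\<dots> = 0"
    using binomial_gbinomial[of 1 "n + 2", where 'a = rat] by simp
  also have "(\<Sum>k=0..n + 2. ?g k * ?g (n + 2 - k))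
      = (\<Sum>k\<le>n. ?g (Suc k) * ?g (Suc (n - k))) + 2 * ?g (n + 2)"
  proof -
    have "(\<Sum>k=0..n + 2. ?g k * ?g (n + 2 - k))
        = ?g (n + 2) + (\<Sum>k\<le>Suc n. ?g (Suc k) * ?g (Suc n - k))"
      by (simp add: atLeast0AtMost sum.atMost_Suc_shift del: sum.atMost_Suc)
    also have "(\<Sum>k\<le>Suc n. ?g (Suc k) * ?g (Suc n - k))
        = (\<Sum>k\<le>n. ?g (Suc k) * ?g (Suc (n - k))) + ?g (n + 2)"
      by (simp add: Suc_diff_le)
    finally show ?thesis by simp
  qed
  finally have V: "(\<Sum>k\<le>n. ?g (Suc k) * ?g (Suc (n - k))) = - 2 * ?g (n + 2)"
    by simp
  \<comment> \<open>The two factors -1/2 make 1/4, and the exponents of -4 add up to n + 2 for every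
    \<open>i\<close>.\<close>
  have "(\<Sum>i\<le>n. catalan i * catalan (n - i))
      = (\<Sum>i\<le>n. (1/4) * (- 4) ^ (n + 2) * (?g (Suc i) * ?g (Suc (n - i))))"
  proof (rule sum.cong)
    fix i assume "i \<in> {..n}"
    then have "(- 4 :: rat) ^ (n + 2) = (- 4) ^ Suc i * (- 4) ^ Suc (n - i)"
      by (simp flip: power_add)
    then show "catalan i * catalan (n - i) = (1/4) * (- 4) ^ (n + 2) * (?g (Suc i) * ?g (Suc (n - i)))"
      unfolding catalan_gbinomial by simp
  qed simp
  also have "\<dots> = (1/4) * (- 4) ^ (n + 2) * (- 2 * ?g (n + 2))"
    unfolding V[symmetric] sum_distrib_left ..
  also have "\<dots> = catalan (Suc n)"
    unfolding catalan_gbinomial by simp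
  finally show ?thesis ..
qed

lemma catalan_fps_eq: "catalan_fps = 1 + fps_X * catalan_fps ^ 2"
proof (rule fps_ext)
  fix n
  show "fps_nth catalan_fps n = fps_nth (1 + fps_X * catalan_fps ^ 2) n"
  proof (cases n)
    case 0
    then show ?thesis by (simp add: catalan_fps_def catalan_def)
  next
    case (Suc m)
    have "fps_nth (catalan_fps ^ 2) m = (\<Sum>i\<le>m. catalan i * catalan (m - i))"
      by (simp add: power2_eq_square fps_mult_nth catalan_fps_def atLeast0AtMost)
    with Suc show ?thesis
      by (simp add: catalan_convolution[of m, symmetric]) (simp add: catalan_fps_def)
  qed
qed

text \<open>Replacing x C^2 by C - 1 twice turns x^2 C^3 into x C^2 - x C and then into C - 1 - x C.
  The factor x^2 avoids division and accounts for the shift by 2.\<close>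

lemma catalan_fps_cube_nth:
  "fps_nth (catalan_fps ^ 3) n = catalan (n + 2) - catalan (n + 1)"
proof -
  have "fps_X ^ 2 * catalan_fps ^ 3 = fps_X * catalan_fps * (fps_X * catalan_fps ^ 2)"
    by (simp add: power2_eq_square power3_eq_cube mult_ac)
  also have "\<dots> = fps_X * catalan_fps * (catalan_fps - 1)"
    by (subst (3) catalan_fps_eq) simp
  also have "\<dots> = fps_X * catalan_fps ^ 2 - fps_X * catalan_fps"
    by (simp add: power2_eq_square algebra_simps)
  also have "\<dots> = catalan_fps - 1 - fps_X * catalan_fps"
    by (subst (3) catalan_fps_eq) simp
  finally have "fps_nth (fps_X ^ 2 * catalan_fps ^ 3) (n + 2)
      = fps_nth (catalan_fps - 1 - fps_X * catalan_fps) (n + 2)"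
    by simp
  then show ?thesis
    by (simp add: fps_X_power_mult_nth catalan_fps_def)
qed

section \<open>Avoiding 312\<close>

text \<open>A 312 lies in the tail or uses the first letter as its 3. The recursive form permits
  induction on words without indices.\<close>

fun avoids_312 :: "nat list \<Rightarrow> bool" where
  "avoids_312 [] \<longleftrightarrow> True"
| "avoids_312 (c # xs) \<longleftrightarrow> avoids_312 xs \<and> sorted_wrt (\<lambda>a b. \<not> (a < b \<and> b < c)) xs"

text \<open>Triples with \<open>i = 0\<close> correspond to the \<open>sorted_wrt\<close> condition,
  the others to the tail.\<close>

lemma avoids_312_iff_nth:
  "avoids_312 xs \<longleftrightarrow>
    (\<forall>i j l. i < j \<longrightarrow> j < l \<longrightarrow> l < length xs \<longrightarrow> \<not> (xs ! j < xs ! l \<and> xs ! l < xs ! i))"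
proof (induction xs)
  case (Cons c xs)
  show ?case (is "_ \<longleftrightarrow> ?R")
  proof
    assume L: "avoids_312 (c # xs)"
    show ?R
    proof (intro allI impI)
      fix i j l assume "i < j" "j < l" "l < length (c # xs)"
      then obtain j' l' where *: "j = Suc j'" "l = Suc l'" "j' < l'" "l' < length xs"
        by (cases j; cases l) auto
      show "\<not> ((c # xs) ! j < (c # xs) ! l \<and> (c # xs) ! l < (c # xs) ! i)"
      proof (cases i)
        case 0
        then show ?thesis using L * by (auto simp: sorted_wrt_iff_nth_less)
      next
        case (Suc i')
        then have "i' < j'" using \<open>i < j\<close> * by simp
        then show ?thesis using L * Suc Cons.IH by auto
      qed
    qed
  next
    assume R: ?R
    have "avoids_312 xs"
      unfolding Cons.IH
    proof (intro allI impI)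
      fix i j l assume "i < j" "j < l" "l < length xs"
      then show "\<not> (xs ! j < xs ! l \<and> xs ! l < xs ! i)"
        using R[rule_format, of "Suc i" "Suc j" "Suc l"] by simp
    qed
    moreover have "sorted_wrt (\<lambda>a b. \<not> (a < b \<and> b < c)) xs"
      unfolding sorted_wrt_iff_nth_less
    proof (intro allI impI)
      fix j l assume "j < l" "l < length xs"
      then show "\<not> (xs ! j < xs ! l \<and> xs ! l < c)"
        using R[rule_format, of 0 "Suc j" "Suc l"] by simp
    qed
    ultimately show "avoids_312 (c # xs)" by simp
  qed
qed simp

lemma order_isomorphic_312_iff: "order_isomorphic [c, a, b] [3, 1, 2] \<longleftrightarrow> a < b \<and> b < c"
  by (auto simp: order_isomorphic_def All_less_Suc numeral_3_eq_3)

text \<open>Between the letters 3 and 1 of a classical 312, the word crosses the value of the letter 2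
  downwards in a single step.\<close>

lemma not_contains_31_2_iff:
  assumes "distinct xs"
  shows "\<not> contains_31_2 xs \<longleftrightarrow> avoids_312 xs"
proof
  assume N: "\<not> contains_31_2 xs"
  show "avoids_312 xs"
    unfolding avoids_312_iff_nth
  proof (intro allI impI notI)
    fix i j l
    assume ij: "i < j" and jl: "j < l" "l < length xs" and v: "xs ! j < xs ! l \<and> xs ! l < xs ! i"
    define m where "m = (LEAST m. i < m \<and> xs ! m < xs ! l)"
    have m: "i < m" "xs ! m < xs ! l"
      unfolding m_def using LeastI[of "\<lambda>m. i < m \<and> xs ! m < xs ! l" j] ij v by auto
    have mj: "m \<le> j"
      unfolding m_def by (rule Least_le) (use ij v in auto)
    obtain p where p: "m = Suc p" using m by (cases m) auto
    have "\<not> (i < p \<and> xs ! p < xs ! l)"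
      using not_less_Least[of p "\<lambda>m. i < m \<and> xs ! m < xs ! l"] p unfolding m_def by auto
    moreover have "xs ! p \<noteq> xs ! l"
      using assms jl mj p by (simp add: nth_eq_iff_index_eq)
    \<comment> \<open>For \<open>p = i\<close> this is \<open>v\<close>; for later \<open>p\<close>,
      minimality of \<open>m\<close> and distinctness leave no other order.\<close>
    ultimately have "xs ! l < xs ! p"
      using v m p by (cases "p = i") auto
    then have "contains_31_2 xs"
      unfolding contains_31_2_def order_isomorphic_312_iff
      using m p mj jl by (intro exI[of _ p] exI[of _ l]) auto
    with N show False ..
  qed
next
  assume "avoids_312 xs"
  then show "\<not> contains_31_2 xs"
    unfolding contains_31_2_def order_isomorphic_312_iff avoids_312_iff_nth by auto
qed

lemma avoids_312_map:
  assumes "\<And>x y. f x < f y \<longleftrightarrow> x < y"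
  shows "avoids_312 (map f xs) \<longleftrightarrow> avoids_312 xs"
  by (induction xs) (simp_all add: sorted_wrt_map assms)

section \<open>Splitting at the minimum and the Catalan recursion\<close>

lemma sorted_wrt_trivial: "(\<And>x y. x \<in> set xs \<Longrightarrow> y \<in> set xs \<Longrightarrow> P x y) \<Longrightarrow> sorted_wrt P xs"
  by (simp add: sorted_wrt_iff_nth_less)

text \<open>If x in \<open>us\<close> exceeds y in \<open>vs\<close>, then x m y is a 312. Otherwise
  a 312 whose 3 is in \<open>us\<close> has its 2 in \<open>us\<close> as well, since
  \<open>m\<close> is too small for a 2, and so it lies within \<open>us\<close>; \<open>m\<close>
  cannot be a 3 either.\<close>

lemma avoids_312_append_min:
  assumes "\<forall>x \<in> set us \<union> set vs. m < x"
  shows "avoids_312 (us @ m # vs) \<longleftrightarrow>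
    avoids_312 us \<and> avoids_312 vs \<and> (\<forall>x \<in> set us. \<forall>y \<in> set vs. x \<le> y)"
  using assms
proof (induction us)
  case Nil
  have "sorted_wrt (\<lambda>a b. \<not> (a < b \<and> b < m)) vs"
    using Nil by (intro sorted_wrt_trivial) (auto simp: not_less less_imp_le)
  then show ?case by simp
next
  case (Cons c us)
  have vs: "sorted_wrt (\<lambda>a b. \<not> (a < b \<and> b < c)) vs" if "\<forall>y \<in> set vs. c \<le> y"
    using that by (intro sorted_wrt_trivial) (auto simp: not_less)
  have "sorted_wrt (\<lambda>a b. \<not> (a < b \<and> b < c)) (us @ m # vs) \<longleftrightarrow>
      sorted_wrt (\<lambda>a b. \<not> (a < b \<and> b < c)) us \<and> (\<forall>y \<in> set vs. c \<le> y)" (is "?L \<longleftrightarrow> ?R")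
  proof
    assume L: ?L
    have "c \<le> y" if "y \<in> set vs" for y
    proof -
      have "\<not> (m < y \<and> y < c)" using L that by (simp add: sorted_wrt_append)
      moreover have "m < y" using Cons.prems that by simp
      ultimately show ?thesis by simp
    qed
    with L show ?R by (simp add: sorted_wrt_append)
  next
    assume ?R
    moreover from this have "sorted_wrt (\<lambda>a b. \<not> (a < b \<and> b < c)) vs" by (intro vs) simp
    moreover have "\<not> x < m" if "x \<in> set us" for x
      using Cons.prems that by (simp add: less_imp_le not_less)
    moreover have "\<not> y < c" if "y \<in> set vs" for y
      using \<open>?R\<close> that by (simp add: not_less)
    ultimately show ?L by (simp add: sorted_wrt_append)
  qed
  moreover have "avoids_312 (us @ m # vs) \<longleftrightarrow>
      avoids_312 us \<and> avoids_312 vs \<and> (\<forall>x \<in> set us. \<forall>y \<in> set vs. x \<le> y)"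
    using Cons by simp
  ultimately show ?case by auto
qed

text \<open>The set of letters is arbitrary because the two parts of a split word use different
  intervals.\<close>

definition av_312 :: "nat set \<Rightarrow> nat list set" where
  "av_312 A = {xs \<in> permutations_of_set A. avoids_312 xs}"

lemma finite_av_312 [simp]: "finite (av_312 A)"
  unfolding av_312_def by (cases "finite A") auto

lemma mem_av_312_iff: "xs \<in> av_312 A \<longleftrightarrow> set xs = A \<and> distinct xs \<and> avoids_312 xs"
  by (auto simp: av_312_def permutations_of_set_def)

text \<open>The minimum of \<open>T\<close> is the cut point. Thus the size of the left part alone
  determines the letters of both parts.\<close>

lemma interval_split:
  fixes S T :: "nat set"
  assumes "S \<union> T = {p..<q}" and "\<And>x y. x \<in> S \<Longrightarrow> y \<in> T \<Longrightarrow> x < y" and "p \<le> q"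
  shows "S = {p..<p + card S} \<and> T = {p + card S..<q} \<and> p + card S \<le> q"
proof (cases "T = {}")
  case True
  then show ?thesis using assms by auto
next
  case False
  have "finite T" using assms(1) by (metis finite_Un finite_atLeastLessThan)
  define t where "t = Min T"
  have t: "t \<in> T" "\<And>y. y \<in> T \<Longrightarrow> t \<le> y"
    unfolding t_def using False \<open>finite T\<close> by auto
  have "t \<in> {p..<q}" using t(1) assms(1) by blast
  have S: "S = {p..<t}"
  proof (intro equalityI subsetI)
    fix x assume "x \<in> S"
    then show "x \<in> {p..<t}"
      using assms(1) assms(2)[OF _ t(1)] by auto
  next
    fix x assume x: "x \<in> {p..<t}"
    then have "x \<in> S \<union> T" using assms(1) \<open>t \<in> {p..<q}\<close> by auto
    then show "x \<in> S" using t(2)[of x] x by auto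
  qed
  moreover have "T = {t..<q}"
  proof (intro equalityI subsetI)
    fix x assume "x \<in> T"
    then show "x \<in> {t..<q}"
      using assms(1) t(2) by auto
  next
    fix x assume x: "x \<in> {t..<q}"
    then have "x \<in> S \<union> T" using assms(1) \<open>t \<in> {p..<q}\<close> by auto
    then show "x \<in> T" using S x by auto
  qed
  ultimately show ?thesis using \<open>t \<in> {p..<q}\<close> by auto
qed

text \<open>Here \<open>i\<close> counts the letters before the minimum \<open>a\<close>. By
  \<open>avoids_312_append_min\<close> the left part takes the \<open>i\<close> smallest remaining
  letters.\<close>

lemma bij_betw_av_312_Suc:
  "bij_betw (\<lambda>(i, us, vs). us @ a # vs)
    (SIGMA i:{..n}. av_312 {Suc a..<Suc a + i} \<times> av_312 {Suc a + i..<Suc a + n})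
    (av_312 {a..<a + Suc n})"
  unfolding bij_betw_def
proof
  show "inj_on (\<lambda>(i, us, vs). us @ a # vs)
      (SIGMA i:{..n}. av_312 {Suc a..<Suc a + i} \<times> av_312 {Suc a + i..<Suc a + n})" (is "inj_on ?f ?D")
  proof (rule inj_onI)
    fix z z' assume "z \<in> ?D" "z' \<in> ?D" "?f z = ?f z'"
    then obtain i us vs i' us' vs' where z: "z = (i, us, vs)" "z' = (i', us', vs')"
      and us: "us \<in> av_312 {Suc a..<Suc a + i}" and us': "us' \<in> av_312 {Suc a..<Suc a + i'}"
      and vs: "vs \<in> av_312 {Suc a + i..<Suc a + n}"
      and eq: "us @ a # vs = us' @ a # vs'"
      by (cases z; cases z') auto
    have "a \<notin> set us" "a \<notin> set vs" "a \<notin> set us'"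
      using us us' vs by (auto simp: mem_av_312_iff)
    \<comment> \<open>The only occurrence of \<open>a\<close> fixes the splitting; \<open>i\<close>
      is then recovered as the length of the left part.\<close>
    then have "us = us' \<and> vs = vs'"
      using eq append_Cons_eq_iff[of a us vs us' vs'] by simp
    moreover have "length us = i" "length us' = i'"
      using us us' distinct_card[of us] distinct_card[of us'] by (auto simp: mem_av_312_iff)
    ultimately show "z = z'" using z by auto
  qed
  show "?f ` ?D = av_312 {a..<a + Suc n}"
  proof (intro equalityI subsetI)
    fix xs assume "xs \<in> ?f ` ?D"
    then obtain i us vs where *: "i \<le> n" "xs = us @ a # vs"
      and us: "set us = {Suc a..<Suc a + i}" "distinct us" "avoids_312 us"
      and vs: "set vs = {Suc a + i..<Suc a + n}" "distinct vs" "avoids_312 vs"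
      by (auto simp: mem_av_312_iff)
    have "avoids_312 xs"
      unfolding *(2) by (subst avoids_312_append_min) (use us vs in auto)
    then show "xs \<in> av_312 {a..<a + Suc n}"
      using * us vs by (auto simp: mem_av_312_iff)
  next
    fix xs assume "xs \<in> av_312 {a..<a + Suc n}"
    then have xs: "set xs = {a..<a + Suc n}" "distinct xs" "avoids_312 xs"
      by (auto simp: mem_av_312_iff)
    then have "a \<in> set xs" by simp
    then obtain us vs where split: "xs = us @ a # vs" by (meson split_list)
    have "a \<notin> set us \<union> set vs" using xs(2) split by auto
    then have un: "set us \<union> set vs = {Suc a..<Suc a + n}"
    proof -
      have "insert a (set us \<union> set vs) = {a..<a + Suc n}"
        using xs(1) split by simp
      also have "\<dots> = insert a {Suc a..<Suc a + n}" by auto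
      finally show ?thesis
        using \<open>a \<notin> set us \<union> set vs\<close> by (simp add: insert_ident)
    qed
    then have "\<forall>x \<in> set us \<union> set vs. a < x" by auto
    then have av: "avoids_312 us" "avoids_312 vs" "\<forall>x \<in> set us. \<forall>y \<in> set vs. x \<le> y"
      using xs(3) avoids_312_append_min unfolding split by blast+
    \<comment> \<open>Distinctness makes the inequality strict, as \<open>interval_split\<close>
      requires.\<close>
    have "\<And>x y. x \<in> set us \<Longrightarrow> y \<in> set vs \<Longrightarrow> x < y"
      using av(3) xs(2) split by (fastforce simp: order_less_le)
    from interval_split[OF un this]
    have "set us = {Suc a..<Suc a + card (set us)}" "set vs = {Suc a + card (set us)..<Suc a + n}"
      "card (set us) \<le> n"
      by auto
    then have mem: "(card (set us), us, vs) \<in> ?D"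
      using av xs(2) split by (simp add: mem_av_312_iff)
    show "xs \<in> ?f ` ?D"
      by (rule image_eqI[OF _ mem]) (simp add: split)
  qed
qed

text \<open>The left end \<open>a\<close> is generalized because the induction hypothesis is applied
  to intervals starting at \<open>Suc a\<close> and at \<open>Suc a + i\<close>.\<close>

lemma card_av_312_interval: "of_nat (card (av_312 {a..<a + n})) = catalan n"
proof (induction n arbitrary: a rule: less_induct)
  case (less n)
  show ?case
  proof (cases n)
    case 0
    have "av_312 {} = {[]}" by (auto simp: mem_av_312_iff)
    with 0 show ?thesis by (simp add: catalan_def)
  next
    case (Suc m)
    have "card (av_312 {a..<a + n})
        = (\<Sum>i\<le>m. card (av_312 {Suc a..<Suc a + i}) * card (av_312 {Suc a + i..<Suc a + m}))"
      unfolding Suc bij_betw_same_card[OF bij_betw_av_312_Suc, symmetric]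
      by (simp add: card_cartesian_product)
    then have "of_nat (card (av_312 {a..<a + n}))
        = (\<Sum>i\<le>m. of_nat (card (av_312 {Suc a..<Suc a + i}))
            * (of_nat (card (av_312 {Suc a + i..<Suc a + m})) :: rat))"
      by simp
    also have "\<dots> = (\<Sum>i\<le>m. catalan i * catalan (m - i))"
    proof (rule sum.cong)
      fix i assume "i \<in> {..m}"
      then show "of_nat (card (av_312 {Suc a..<Suc a + i}))
          * of_nat (card (av_312 {Suc a + i..<Suc a + m})) = catalan i * catalan (m - i)"
        using less[of i "Suc a"] less[of "m - i" "Suc a + i"] Suc by auto
    qed simp
    finally show ?thesis
      unfolding Suc catalan_convolution .
  qed
qed

lemma card_av_312: "of_nat (card (av_312 {1..n})) = catalan n"
  using card_av_312_interval[of 1 n] by (simp add: atLeastLessThanSuc_atLeastAtMost)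

section \<open>Doubling the first letter\<close>

definition shift_above :: "nat \<Rightarrow> nat \<Rightarrow> nat" where
  "shift_above a x = (if x \<le> a then x else Suc x)"

text \<open>The doubled first letter b becomes the descent b + 1, b; \<open>shift_above\<close>
  frees the value b + 1.\<close>

definition inflate :: "nat list \<Rightarrow> nat list" where
  "inflate xs = Suc (hd xs) # map (shift_above (hd xs)) xs"

lemma shift_above_less_iff [simp]: "shift_above a x < shift_above a y \<longleftrightarrow> x < y"
  by (auto simp: shift_above_def)

lemma shift_above_eq_iff [simp]: "shift_above a x = shift_above a y \<longleftrightarrow> x = y"
  by (auto simp: shift_above_def)

lemma shift_above_self [simp]: "shift_above a a = a"
  by (simp add: shift_above_def)

lemma shift_above_image:
  assumes "a \<in> {1..n}"
  shows "shift_above a ` {1..n} = {1..Suc n} - {Suc a}"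
proof (intro equalityI subsetI)
  fix x assume "x \<in> {1..Suc n} - {Suc a}"
  \<comment> \<open>Above the gap, x - 1 still exceeds \<open>a\<close> because x differs from
    \<open>Suc a\<close>.\<close>
  then have "x = shift_above a (if x \<le> a then x else x - 1)" "(if x \<le> a then x else x - 1) \<in> {1..n}"
    using assms by (auto simp: shift_above_def)
  then show "x \<in> shift_above a ` {1..n}" by blast
qed (use assms in \<open>auto simp: shift_above_def split: if_splits\<close>)

text \<open>A 2 below the new 3 \<open>Suc b\<close> is at most \<open>b\<close>, and by
  distinctness less than \<open>b\<close> if it occurs in \<open>ys\<close>. With its 1 also in
  \<open>ys\<close>, the letter \<open>b\<close> would already serve as the 3; with \<open>b\<close>
  as the 1, no value is left for the 2.\<close>

lemma avoids_312_Cons_Suc_hd: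
  assumes "avoids_312 (b # ys)" "distinct (b # ys)"
  shows "avoids_312 (Suc b # b # ys)"
proof -
  have "sorted_wrt (\<lambda>x y. \<not> (x < y \<and> y < Suc b)) ys"
    by (rule sorted_wrt_mono_rel[of ys "\<lambda>x y. \<not> (x < y \<and> y < b)"])
      (use assms in \<open>auto simp: less_Suc_eq\<close>)
  with assms show ?thesis by auto
qed

text \<open>The first letter of the image reveals the shift, which is injective.\<close>

lemma inj_on_inflate: "inj_on inflate {xs. xs \<noteq> []}"
proof (rule inj_onI)
  fix xs ys assume eq: "inflate xs = inflate ys"
  then have hd: "hd xs = hd ys" by (simp add: inflate_def)
  have "map (shift_above (hd ys)) xs = map (shift_above (hd ys)) ys"
    using eq by (simp add: inflate_def hd)
  moreover have "inj (shift_above (hd ys))" by (rule injI) simp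
  ultimately show "xs = ys" by (simp add: inj_map_eq_map)
qed

text \<open>Any initial descent consists of consecutive values, so deleting its top and closing the
  gap inverts \<open>inflate\<close>. The bound on \<open>n\<close> guarantees that positions 0 and
  1 exist.\<close>

lemma inflate_av_312:
  assumes "n \<ge> 1"
  shows "inflate ` av_312 {1..n} = {ys \<in> av_312 {1..Suc n}. ys ! 1 < ys ! 0}"
proof (intro equalityI subsetI)
  fix ys assume "ys \<in> inflate ` av_312 {1..n}"
  then obtain xs where ys: "ys = inflate xs" and xs: "set xs = {1..n}" "distinct xs" "avoids_312 xs"
    by (auto simp: mem_av_312_iff)
  then have "xs \<noteq> []" using assms by auto
  then obtain b zs where b: "xs = b # zs" by (cases xs) auto
  have bn: "b \<in> {1..n}" using b xs(1) by auto
  have s: "set (map (shift_above b) xs) = {1..Suc n} - {Suc b}"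
    using shift_above_image[OF bn] xs(1) by simp
  have d: "distinct (map (shift_above b) xs)"
    using xs(2) by (simp add: distinct_map inj_on_def)
  have a: "avoids_312 (map (shift_above b) xs)"
    using xs(3) by (simp add: avoids_312_map)
  have "avoids_312 ys"
    using avoids_312_Cons_Suc_hd[of b "map (shift_above b) zs"] a d
    unfolding ys inflate_def b by simp
  moreover have "distinct ys" "set ys = {1..Suc n}"
    using s d bn unfolding ys inflate_def b by auto
  ultimately show "ys \<in> {ys \<in> av_312 {1..Suc n}. ys ! 1 < ys ! 0}"
    by (simp add: mem_av_312_iff ys inflate_def b)
next
  fix ys assume "ys \<in> {ys \<in> av_312 {1..Suc n}. ys ! 1 < ys ! 0}"
  then have ys: "set ys = {1..Suc n}" "distinct ys" "avoids_312 ys" and desc: "ys ! 1 < ys ! 0"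
    by (auto simp: mem_av_312_iff)
  have "length ys = Suc n" using distinct_card[OF ys(2)] ys(1) by simp
  then obtain c b zs where cb: "ys = c # b # zs"
    using assms by (cases ys; cases "tl ys") auto
  \<comment> \<open>Otherwise \<open>Suc b\<close> occurs in \<open>zs\<close> and completes the 312
    formed by \<open>c\<close>, \<open>b\<close>, \<open>Suc b\<close>.\<close>
  have c: "c = Suc b"
  proof (rule ccontr)
    assume "c \<noteq> Suc b"
    then have lt: "Suc b < c" using desc cb by simp
    moreover have "c \<in> {1..Suc n}" using ys(1) cb by auto
    ultimately have "Suc b \<in> set ys" using ys(1) by simp
    then have "Suc b \<in> set zs" using cb lt by auto
    then show False using ys(3) cb lt by auto
  qed
  have "b \<in> {1..Suc n}" "c \<in> {1..Suc n}" unfolding ys(1)[symmetric] cb by simp_all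
  then have bn: "b \<in> {1..n}" using c by simp
  have "set (b # zs) = {1..Suc n} - {Suc b}" using ys(1,2) cb c by auto
  then have set_tl: "set (b # zs) = shift_above b ` {1..n}" using shift_above_image[OF bn] by simp
  \<comment> \<open>This closes the gap at \<open>Suc b\<close>; \<open>inv\<close> is a true
    inverse here because, by \<open>set_tl\<close>, all letters lie in the range of the
    shift.\<close>
  define xs where "xs = map (inv (shift_above b)) (b # zs)"
  have inj: "inj (shift_above b)" by (rule injI) simp
  have m: "map (shift_above b) xs = b # zs"
  proof -
    have "x \<in> range (shift_above b)" if "x \<in> set (b # zs)" for x
      using that unfolding set_tl by blast
    then show ?thesis
      unfolding xs_def map_map by (intro map_idI) (simp only: comp_apply f_inv_into_f)
  qed
  have "shift_above b ` set xs = shift_above b ` {1..n}"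
    using set_tl m by (metis set_map)
  then have "set xs = {1..n}" using inj by (simp add: inj_image_eq_iff)
  moreover have "distinct xs" using m ys(2) cb by (metis distinct.simps(2) distinct_map)
  moreover have "avoids_312 xs"
    using m ys(3) cb avoids_312_map[of "shift_above b" xs] by simp
  moreover have "hd xs = b"
    using inj inv_f_f[of "shift_above b" b] by (simp add: xs_def)
  then have "inflate xs = ys" using m by (simp add: inflate_def cb c)
  ultimately show "ys \<in> inflate ` av_312 {1..n}"
    by (auto simp: mem_av_312_iff)
qed

section \<open>The prefix pattern\<close>

lemma length_prefix_pattern: "k \<ge> 1 \<Longrightarrow> length (prefix_pattern k) = k"
  by (simp add: prefix_pattern_def)

lemma prefix_pattern_nth:
  "i < k \<Longrightarrow> prefix_pattern k ! i = (if Suc i < k then k - Suc i else k)"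
  by (auto simp: prefix_pattern_def nth_append rev_nth)

text \<open>For \<open>k >= 2\<close> the pattern is not \<open>[1]\<close>, so the convention for
  the empty permutation does not apply. The two conditions decide every comparison, according to
  whether the last position \<open>k - 1\<close> is involved.\<close>

lemma begins_with_prefix_pattern_iff:
  assumes "k \<ge> 2"
  shows "begins_with (prefix_pattern k) xs \<longleftrightarrow>
    k \<le> length xs \<and> (\<forall>j < k - 1. xs ! j < xs ! (k - 1)) \<and> (\<forall>j < k - 1. \<forall>i < j. xs ! j < xs ! i)"
  (is "_ \<longleftrightarrow> ?R")
proof -
  have len: "length (prefix_pattern k) = k" using assms by (simp add: length_prefix_pattern)
  have "prefix_pattern k \<noteq> [1]" using len assms by auto
  then have "begins_with (prefix_pattern k) xs \<longleftrightarrow> k \<le> length xs \<and>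
      (\<forall>i < k. \<forall>j < k. xs ! i < xs ! j \<longleftrightarrow> prefix_pattern k ! i < prefix_pattern k ! j)"
    by (auto simp: begins_with_def order_isomorphic_def len)
  also have "\<dots> \<longleftrightarrow> ?R"
  proof (intro conj_cong refl iffI)
    assume *: "\<forall>i < k. \<forall>j < k. xs ! i < xs ! j \<longleftrightarrow> prefix_pattern k ! i < prefix_pattern k ! j"
    show "(\<forall>j < k - 1. xs ! j < xs ! (k - 1)) \<and> (\<forall>j < k - 1. \<forall>i < j. xs ! j < xs ! i)"
    proof (intro conjI allI impI)
      fix j assume "j < k - 1"
      then show "xs ! j < xs ! (k - 1)"
        using *[rule_format, of j "k - 1"] by (simp add: prefix_pattern_nth)
    next
      fix i j assume "j < k - 1" "i < j"
      then have "i < k" "j < k" "Suc i < k" "Suc j < k" by simp_all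
      with \<open>i < j\<close> show "xs ! j < xs ! i"
        using *[rule_format, of j i] by (simp add: prefix_pattern_nth)
    qed
  next
    assume *: "(\<forall>j < k - 1. xs ! j < xs ! (k - 1)) \<and> (\<forall>j < k - 1. \<forall>i < j. xs ! j < xs ! i)"
    show "\<forall>i < k. \<forall>j < k. xs ! i < xs ! j \<longleftrightarrow> prefix_pattern k ! i < prefix_pattern k ! j"
    proof (intro allI impI)
      fix i j assume ij: "i < k" "j < k"
      consider "i = k - 1" "j = k - 1" | "i = k - 1" "j < k - 1" | "i < k - 1" "j = k - 1"
        | "i < k - 1" "j < k - 1"
        using ij by linarith
      then show "xs ! i < xs ! j \<longleftrightarrow> prefix_pattern k ! i < prefix_pattern k ! j"
      proof cases
        case 1
        then show ?thesis by simp
      next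
        case 2
        then have "xs ! j < xs ! i" using * by simp
        then show ?thesis using 2 ij by (auto simp: prefix_pattern_nth)
      next
        case 3
        then have "xs ! i < xs ! j" using * by simp
        then show ?thesis using 3 ij by (auto simp: prefix_pattern_nth)
      next
        case 4
        show ?thesis
        proof (cases i j rule: linorder_cases)
          case less
          then have "xs ! j < xs ! i" using * 4 by simp
          then show ?thesis using 4 less ij by (auto simp: prefix_pattern_nth)
        next
          case greater
          then have "xs ! i < xs ! j" using * 4 by simp
          then show ?thesis using 4 greater ij by (auto simp: prefix_pattern_nth)
        qed simp
      qed
    qed
  qed
  finally show ?thesis .
qed

text \<open>The shift preserves comparisons among old letters, so only those with the new first
  letter need checking; they follow from comparisons with \<open>xs ! 0\<close>.\<close>

lemma begins_with_inflate_iff: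
  assumes "k \<ge> 2" "xs \<noteq> []"
  shows "begins_with (prefix_pattern (Suc k)) (inflate xs) \<longleftrightarrow> begins_with (prefix_pattern k) xs"
proof -
  obtain l where k: "k = Suc (Suc l)" using assms(1) by (metis add_2_eq_Suc le_Suc_ex)
  let ?s = "shift_above (hd xs)"
  have hd: "hd xs = xs ! 0" using assms(2) by (rule hd_conv_nth)
  have nth: "inflate xs ! 0 = Suc (xs ! 0)" by (simp add: inflate_def hd)
  have nthS: "inflate xs ! Suc i = ?s (xs ! i)" if "i < length xs" for i
    using that by (simp add: inflate_def)
  have below: "?s x < Suc (xs ! 0) \<longleftrightarrow> x \<le> xs ! 0" and above: "Suc (xs ! 0) < ?s x \<longleftrightarrow> xs ! 0 < x" for x
    by (auto simp: shift_above_def hd)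
  have "begins_with (prefix_pattern (Suc k)) (inflate xs) \<longleftrightarrow>
      k \<le> length xs \<and> (\<forall>j < Suc (Suc l). inflate xs ! j < inflate xs ! Suc (Suc l)) \<and>
      (\<forall>j < Suc (Suc l). \<forall>i < j. inflate xs ! j < inflate xs ! i)"
    using assms by (subst begins_with_prefix_pattern_iff) (auto simp: k inflate_def)
  \<comment> \<open>Position 0 is split off; comparing it with the later decreasing letters adds
    only \<open>xs ! j <= xs ! 0\<close>, which the decrease itself implies.\<close>
  also have "\<dots> \<longleftrightarrow> k \<le> length xs \<and> (\<forall>j < Suc l. xs ! j < xs ! Suc l) \<and>
      (\<forall>j < Suc l. xs ! j \<le> xs ! 0 \<and> (\<forall>i < j. xs ! j < xs ! i))"
    by (rule conj_cong[OF refl])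
      (auto simp: All_less_Suc2 nth nthS below above k)
  also have "\<dots> \<longleftrightarrow> begins_with (prefix_pattern k) xs"
  proof -
    have "xs ! j \<le> xs ! 0" if "\<forall>i < j. xs ! j < xs ! i" for j
      using that by (cases j) (auto simp: less_imp_le)
    then show ?thesis
      using assms by (subst begins_with_prefix_pattern_iff) (auto simp: k)
  qed
  finally show ?thesis .
qed

section \<open>Counting avoiders that begin with the prefix pattern\<close>

lemma N_31_2_eq: "N_31_2 p n = card {xs \<in> av_312 {1..n}. begins_with p xs}"
proof -
  have "{xs \<in> permutations_of_set {1..n}. \<not> contains_31_2 xs \<and> begins_with p xs}
      = {xs \<in> av_312 {1..n}. begins_with p xs}"
    unfolding av_312_def permutations_of_set_def by (auto dest: not_contains_31_2_iff)
  then show ?thesis by (simp add: N_31_2_def)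
qed

lemma length_av_312: "xs \<in> av_312 {1..n} \<Longrightarrow> length xs = n"
  using distinct_card[of xs] by (simp add: mem_av_312_iff)

lemma N_31_2_less:
  assumes "k \<ge> 2" "n < k"
  shows "N_31_2 (prefix_pattern k) n = 0"
proof -
  have "\<not> begins_with (prefix_pattern k) xs" if "xs \<in> av_312 {1..n}" for xs
    using length_av_312[OF that] assms by (simp add: begins_with_prefix_pattern_iff)
  then have "{xs \<in> av_312 {1..n}. begins_with (prefix_pattern k) xs} = {}" by blast
  then show ?thesis by (simp only: N_31_2_eq card.empty)
qed

text \<open>Every word begins with 1, the empty one by convention, so all avoiders are
  counted.\<close>

lemma N_31_2_prefix_pattern_1: "of_nat (N_31_2 (prefix_pattern 1) n) = catalan n"
proof -
  have "begins_with (prefix_pattern 1) xs" for xs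
    by (cases xs) (auto simp: begins_with_def order_isomorphic_def prefix_pattern_def)
  then show ?thesis using card_av_312[of n] by (simp add: N_31_2_eq)
qed

text \<open>Beginning with 12 is the complement of beginning with a descent, and
  \<open>inflate\<close> counts the latter by the avoiders of length n + 1.\<close>

lemma N_31_2_prefix_pattern_2:
  "of_nat (N_31_2 (prefix_pattern 2) (n + 2)) = catalan (n + 2) - catalan (n + 1)"
proof -
  let ?A = "av_312 {1..Suc (Suc n)}" and ?D = "{ys \<in> av_312 {1..Suc (Suc n)}. ys ! 1 < ys ! 0}"
  have "{xs \<in> ?A. begins_with (prefix_pattern 2) xs} = ?A - ?D"
  proof -
    have "begins_with (prefix_pattern 2) xs \<longleftrightarrow> \<not> xs ! 1 < xs ! 0" if "xs \<in> ?A" for xs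
    proof -
      have "xs ! 1 \<noteq> xs ! 0"
        using that length_av_312[OF that] by (simp add: mem_av_312_iff nth_eq_iff_index_eq)
      then show ?thesis
        using length_av_312[OF that] by (auto simp: begins_with_prefix_pattern_iff)
    qed
    then show ?thesis by auto
  qed
  then have N: "N_31_2 (prefix_pattern 2) (n + 2) = card ?A - card ?D"
    by (simp add: N_31_2_eq card_Diff_subset)
  have "inj_on inflate (av_312 {1..Suc n})"
    by (rule inj_on_subset[OF inj_on_inflate]) (auto simp: mem_av_312_iff)
  then have "card ?D = card (av_312 {1..Suc n})"
    using inflate_av_312[of "Suc n"] card_image by fastforce
  moreover have "card ?D \<le> card ?A" by (rule card_mono) auto
  ultimately show ?thesis
    unfolding N using card_av_312[of "Suc n"] card_av_312[of "Suc (Suc n)"] by (simp add: of_nat_diff)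
qed

lemma N_31_2_prefix_pattern_Suc:
  assumes "k \<ge> 2"
  shows "N_31_2 (prefix_pattern (Suc k)) (Suc n) = N_31_2 (prefix_pattern k) n"
proof (cases "n = 0")
  case True
  then show ?thesis using assms by (simp add: N_31_2_less)
next
  case False
  have nonempty: "xs \<noteq> []" if "xs \<in> av_312 {1..n}" for xs
    using that False by (auto simp: mem_av_312_iff)
  \<comment> \<open>The pattern for \<open>Suc k\<close> has length at least 3 and starts with a
    descent, so the word is in the image of \<open>inflate\<close>.\<close>
  have "{ys \<in> av_312 {1..Suc n}. begins_with (prefix_pattern (Suc k)) ys}
      = {ys \<in> inflate ` av_312 {1..n}. begins_with (prefix_pattern (Suc k)) ys}"
    using inflate_av_312[of n] False assms by (auto simp: begins_with_prefix_pattern_iff)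
  also have "\<dots> = inflate ` {xs \<in> av_312 {1..n}. begins_with (prefix_pattern k) xs}"
    using begins_with_inflate_iff[OF assms nonempty] by auto
  finally have eq: "{ys \<in> av_312 {1..Suc n}. begins_with (prefix_pattern (Suc k)) ys}
      = inflate ` {xs \<in> av_312 {1..n}. begins_with (prefix_pattern k) xs}" .
  have "inj_on inflate {xs \<in> av_312 {1..n}. begins_with (prefix_pattern k) xs}"
    by (rule inj_on_subset[OF inj_on_inflate]) (use nonempty in auto)
  then show ?thesis
    unfolding N_31_2_eq eq by (rule card_image)
qed

text \<open>The excess \<open>n\<close> of the length over \<open>k\<close> is held fixed, since
  \<open>inflate\<close> raises both by one.\<close>

lemma N_31_2_prefix_pattern:
  assumes "k \<ge> 2"
  shows "of_nat (N_31_2 (prefix_pattern k) (n + k)) = catalan (n + 2) - catalan (n + 1)"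
  using assms
proof (induction k rule: dec_induct)
  case base
  show ?case by (rule N_31_2_prefix_pattern_2)
next
  case (step k)
  then show ?case using N_31_2_prefix_pattern_Suc[of k "n + k"] by simp
qed

theorem proposition20:
  fixes k :: nat
  assumes "k \<ge> 1"
  shows "G_31_2 (prefix_pattern k) = (if k \<ge> 2 then fps_X ^ k * catalan_fps ^ 3 else catalan_fps) \<and>
    (\<forall>n\<ge>k. of_nat (N_31_2 (prefix_pattern k) n) =
           (if k \<ge> 2 then catalan (n - k + 2) - catalan (n - k + 1) else catalan n))"
proof (cases "k \<ge> 2")
  case True
  have N: "of_nat (N_31_2 (prefix_pattern k) n) = catalan (n - k + 2) - catalan (n - k + 1)"
    if "n \<ge> k" for n
    using N_31_2_prefix_pattern[OF True, of "n - k"] that by simp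
  have "G_31_2 (prefix_pattern k) = fps_X ^ k * catalan_fps ^ 3"
  proof (rule fps_ext)
    fix n
    show "fps_nth (G_31_2 (prefix_pattern k)) n = fps_nth (fps_X ^ k * catalan_fps ^ 3) n"
      \<comment> \<open>Coefficients below degree \<open>k\<close> vanish on both sides; from there
        on, that of C^3 at n - k is compared.\<close>
      using True N[of n] N_31_2_less[OF True, of n]
      by (simp add: G_31_2_def fps_X_power_mult_nth catalan_fps_cube_nth)
  qed
  with True N show ?thesis by simp
next
  case False
  then have "k = 1" using assms by simp
  then show ?thesis
    using N_31_2_prefix_pattern_1 by (simp add: G_31_2_def catalan_fps_def)
qed

end
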